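(* Let $F$ be an infinite field. If $Q$ and $R$ are two distinct super-distinct (Rogers-Ramanujan) partitions, then $Q$ and $R$ are not commuting partitions over $F$; that is, there do not exist two commuting nilpotent matrices $A$ and $B$ over $F$ such that the Jordan type of $A$ is $Q$ and the Jordan type of $B$ is $R$.
   Context: A partition of a natural number $n$ is written $P=(p_1,p_2,\ldots,p_k)$ with $p_1\ge p_2\ge\cdots\ge p_k>0$ and $p_1+\cdots+p_k=n$. A partition $Q=(q_1,q_2,\ldots,q_k)$ is called super-distinct, or Rogers-Ramanujan, if its parts differ by at least $2$, i.e. $q_i-q_{i+1}\ge 2$ for $i=1,2,\ldots,k-1$. Let $M_n(F)$ denote the algebra of all $n\times n$ matrices over $F$. The Jordan type of a nilpotent matrix $B\in M_n(F)$ is the partition $P_B=(p_1,\ldots,p_k)$ of $n$ whose parts $p_1\ge p_2\ge\cdots\ge p_k>0$ are the sizes of the Jordan blocks in the Jordan canonical form of $B$. Two partitions $P$ and $Q$ are called commuting partitions (over $F$) if there exist two commuting nilpotent matrices $A$ and $B$ over $F$ (of the same size, $AB=BA$) such that $P_A=P$ and $P_B=Q$. *)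

theory Defs
  imports "Jordan_Normal_Form.Jordan_Normal_Form"
begin

definition partition_of :: "nat \<Rightarrow> nat list \<Rightarrow> bool" where
  "partition_of n P \<longleftrightarrow> sorted_wrt (\<ge>) P \<and> (\<forall>p \<in> set P. p > 0) \<and> sum_list P = n"

(* Consecutive parts differ by at least 2; written additively because
   subtraction on nat truncates. *)
definition super_distinct :: "nat list \<Rightarrow> bool" where
  "super_distinct Q \<longleftrightarrow> (\<forall>i. Suc i < length Q \<longrightarrow> Q ! i \<ge> Q ! Suc i + 2)"

definition nilpotent_mat :: "'a :: semiring_1 mat \<Rightarrow> bool" where
  "nilpotent_mat A \<longleftrightarrow> square_mat A \<and> (\<exists>k. A ^\<^sub>m k = 0\<^sub>m (dim_row A) (dim_row A))"

(* jordan_nf does not prescribe the order of the Jordan blocks, so P is compared with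
   the multiset of block sizes; P itself is the weakly decreasing arrangement.
   Eigenvalues are ignored: only meant for nilpotent A, where they are all 0. *)
definition has_jordan_type :: "'a :: field mat \<Rightarrow> nat list \<Rightarrow> bool" where
  "has_jordan_type A P \<longleftrightarrow> partition_of (dim_row A) P \<and>
     (\<exists>n_as. jordan_nf A n_as \<and> mset (map fst n_as) = mset P)"

(* The type argument is the ground field, which P and Q do not determine. *)
definition commuting_partitions :: "'a :: field itself \<Rightarrow> nat list \<Rightarrow> nat list \<Rightarrow> bool" where
  "commuting_partitions F P Q \<longleftrightarrow>
     (\<exists>n. \<exists>A \<in> carrier_mat n n. \<exists>B \<in> carrier_mat n n.
        nilpotent_mat (A :: 'a mat) \<and> nilpotent_mat (B :: 'a mat) \<and> A * B = B * A \<and>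
        has_jordan_type A P \<and> has_jordan_type B Q)"

end

(* If B is nilpotent with super-distinct Jordan type R, then R dominates the type of every
   nilpotent A commuting with B, i.e. dim ker A^m >= dim ker B^m for all m; two super-distinct
   types that commute therefore dominate each other and agree. For the inequality let B act as
   multiplication by t on the direct sum of the F[t]/(t^p), p in R. The entry of A from the block p
   to the block q is divisible by t^max(0, q - p), and by t if p = q because A is nilpotent and the
   parts are distinct. Let h(p) be the number of parts below p and a the number of parts below m.
   As parts differ by at least 2, A maps the sum of the t^max(0, s + h(p) - a) F[t]/(t^p) into the
   same sum with s + 1 in place of s. So A^m maps the submodule for s = 0 into the one for s = m,
   and the difference of their dimensions is the sum of the min(m, p), which is dim ker B^m. *)

theory Submission
  imports Defs "Jordan_Normal_Form.Jordan_Normal_Form_Uniqueness"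
begin

section \<open>Lower bounds for kernel dimensions\<close>

lemma kernel_dim_mono:
  fixes A B :: "'a :: field mat"
  assumes A: "A \<in> carrier_mat nr nc" and B: "B \<in> carrier_mat nr' nc"
    and sub: "mat_kernel A \<subseteq> mat_kernel B"
  shows "kernel_dim A \<le> kernel_dim B"
proof -
  interpret KA: kernel nr nc A by unfold_locales (rule A)
  interpret KB: kernel nr' nc B by unfold_locales (rule B)
  obtain U where U: "finite U" "KA.basis U" using kernel_basis_exists[OF A] by blast
  obtain W where W: "finite W" "KB.basis W" using kernel_basis_exists[OF B] by blast
  from U have UA: "U \<subseteq> mat_kernel A" "KA.lin_indpt U" by (auto simp: KA.Ker.basis_def)
  \<comment> \<open>Independence in either kernel is independence in the common ambient space, so it
    passes from one kernel to the other.\<close>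
  have "KB.lin_indpt U"
    using UA sub KA.lindep_same[of U] KB.lindep_same[of U] by auto
  moreover have "KB.Ker.fin_dim"
    using W unfolding KB.Ker.fin_dim_def KB.Ker.basis_def by blast
  ultimately have "card U \<le> KB.dim"
    using KB.Ker.li_le_dim(2)[of U] UA sub by auto
  moreover have "card U = KA.dim" using KA.Ker.dim_basis[OF U] by simp
  ultimately show ?thesis by simp
qed

text \<open>Row reduction keeps the kernel, and its dimension is the number of columns minus the
  number of nonzero rows of the echelon form, of which there are at most \<open>nr\<close>.\<close>

lemma dim_col_le_kernel_dim_add_dim_row:
  fixes A :: "'a :: field mat"
  assumes A: "A \<in> carrier_mat nr nc"
  shows "nc \<le> kernel_dim A + nr"
proof -
  obtain C where gj: "gauss_jordan_single A = C" by auto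
  from gauss_jordan_single[OF A gj]
  obtain P Q where CPA: "C = P * A" and QP: "Q * P = 1\<^sub>m nr"
    and P: "P \<in> carrier_mat nr nr" and Q: "Q \<in> carrier_mat nr nr"
    and C: "C \<in> carrier_mat nr nc" and row: "row_echelon_form C"
    by auto
  have "mat_kernel C = mat_kernel A"
    unfolding CPA by (rule mat_kernel_mult_eq[OF A P Q QP])
  hence "kernel_dim A = nc - card {i. i < nr \<and> row C i \<noteq> 0\<^sub>v nc}"
    using find_base_vectors(6)[OF row C] A unfolding kernel_dim_def by simp
  moreover have "card {i. i < nr \<and> row C i \<noteq> 0\<^sub>v nc} \<le> card {..<nr}"
    by (rule card_mono) auto
  ultimately show ?thesis by simp
qed

text \<open>A vector supported on \<open>X\<close> has its image supported on \<open>Y\<close>. It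
  therefore lies in the kernel as soon as the \<open>card Y\<close> coordinates of the image in
  \<open>Y\<close> vanish. Together with the \<open>n - card X\<close> conditions that force the
  support into \<open>X\<close>, these are the rows of \<open>V\<close>.\<close>

lemma kernel_dim_zero_block:
  fixes A :: "'a :: field mat"
  assumes A: "A \<in> carrier_mat n n" and X: "X \<subseteq> {..<n}" and Y: "Y \<subseteq> {..<n}"
    and zero: "\<And>i j. i < n \<Longrightarrow> j \<in> X \<Longrightarrow> i \<notin> Y \<Longrightarrow> A $$ (i, j) = 0"
  shows "card X \<le> kernel_dim A + card Y"
proof -
  define us :: "'a vec list" where "us = map (unit_vec n) (filter (\<lambda>j. j \<notin> X) [0..<n])"
  define vs where "vs = map (row A) (filter (\<lambda>i. i \<in> Y) [0..<n])"
  define V where "V = mat_of_rows n (us @ vs)"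
  have fX: "set (filter (\<lambda>j. j \<notin> X) [0..<n]) = {..<n} - X"
    and fY: "set (filter (\<lambda>i. i \<in> Y) [0..<n]) = Y" using Y by auto
  have "length us = card ({..<n} - X)"
    unfolding us_def length_map fX[symmetric] by (rule distinct_card[symmetric]) simp
  also have "\<dots> = n - card X" using X by (simp add: card_Diff_subset finite_subset)
  finally have lu: "length us = n - card X" .
  have "length vs = card Y"
    unfolding vs_def length_map by (subst fY[symmetric], rule distinct_card[symmetric]) simp
  with lu have len: "length (us @ vs) = n - card X + card Y" by simp
  have V: "V \<in> carrier_mat (n - card X + card Y) n" unfolding V_def using len by auto
  have carr: "set (us @ vs) \<subseteq> carrier_vec n" using A by (auto simp: us_def vs_def)
  have "mat_kernel V \<subseteq> mat_kernel A"
  proof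
    fix v assume "v \<in> mat_kernel V"
    from mat_kernelD[OF V this] have v: "v \<in> carrier_vec n"
      and Vv: "V *\<^sub>v v = 0\<^sub>v (n - card X + card Y)" by auto
    have orth: "w \<bullet> v = 0" if "w \<in> set (us @ vs)" for w
    proof -
      from that obtain i where i: "i < length (us @ vs)" "w = (us @ vs) ! i"
        by (metis in_set_conv_nth)
      have "row V i = w" unfolding V_def
        using i carr that by (metis mat_of_rows_row subsetD)
      with arg_cong[OF Vv, of "\<lambda>x. x $ i"] i V len show ?thesis by auto
    qed
    have vX: "v $ j = 0" if "j < n" "j \<notin> X" for j
      using orth[of "unit_vec n j"] that v by (auto simp: us_def)
    have "A *\<^sub>v v = 0\<^sub>v n"
    proof (rule eq_vecI)
      fix i assume "i < dim_vec (0\<^sub>v n :: 'a vec)"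
      hence i: "i < n" by simp
      show "(A *\<^sub>v v) $ i = 0\<^sub>v n $ i"
      proof (cases "i \<in> Y")
        case True
        thus ?thesis using orth[of "row A i"] i A by (auto simp: vs_def)
      next
        case False
        have "row A i \<bullet> v = (\<Sum>j = 0..<n. A $$ (i, j) * v $ j)"
          using A v i by (auto simp: scalar_prod_def)
        also have "\<dots> = 0"
          using zero[OF i _ False] vX
          by (intro sum.neutral ballI) (metis atLeastLessThan_iff mult_zero_left mult_zero_right)
        finally show ?thesis using A i by auto
      qed
    qed (use A in auto)
    thus "v \<in> mat_kernel A" using mat_kernelI[OF A v] by simp
  qed
  from kernel_dim_mono[OF V A this] dim_col_le_kernel_dim_add_dim_row[OF V]
  show ?thesis using card_mono[OF _ X] by simp
qed

section \<open>Powers, similarity and eigenvalues of nilpotent matrices\<close>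

lemma pow_mat_mult_commute:
  fixes A B :: "'a :: semiring_1 mat"
  assumes A: "A \<in> carrier_mat n n" and B: "B \<in> carrier_mat n n" and AB: "A * B = B * A"
  shows "A ^\<^sub>m k * B = B * A ^\<^sub>m k"
proof (induction k)
  case 0
  show ?case using A B by simp
next
  case (Suc k)
  have Ak: "A ^\<^sub>m k \<in> carrier_mat n n" using A by simp
  have "A ^\<^sub>m Suc k * B = A ^\<^sub>m k * (B * A)"
    using assoc_mult_mat[OF Ak A B] AB by simp
  also have "\<dots> = (A ^\<^sub>m k * B) * A" using assoc_mult_mat[OF Ak B A] by simp
  also have "\<dots> = B * A ^\<^sub>m Suc k" using assoc_mult_mat[OF B Ak A] unfolding Suc by simp
  finally show ?case .
qed

lemma nilpotent_mat_similar:
  assumes "nilpotent_mat A" and sim: "similar_mat_wit A B P Q"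
  shows "nilpotent_mat B"
proof -
  from similar_mat_witD[OF refl similar_mat_wit_sym[OF sim]] obtain n where
    n: "A \<in> carrier_mat n n" "B \<in> carrier_mat n n" "P \<in> carrier_mat n n" "Q \<in> carrier_mat n n"
    by blast
  from assms(1) n obtain k where k: "A ^\<^sub>m k = 0\<^sub>m n n" by (auto simp: nilpotent_mat_def)
  have "B ^\<^sub>m k = Q * A ^\<^sub>m k * P" by (rule similar_mat_wit_pow_id[OF similar_mat_wit_sym[OF sim]])
  thus ?thesis using n k by (auto simp: nilpotent_mat_def)
qed

lemma jordan_nf_nilpotent_eigenvalue:
  fixes A :: "'a :: field mat"
  assumes nil: "nilpotent_mat A" and jnf: "jordan_nf A n_as" and mem: "(p, a) \<in> set n_as"
  shows "a = 0"
proof -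
  from nil obtain n k where A: "A \<in> carrier_mat n n" and k: "A ^\<^sub>m k = 0\<^sub>m n n"
    by (auto simp: nilpotent_mat_def)
  \<comment> \<open>A block of size 0 would contribute only the factor 1 to the characteristic
    polynomial, so \<open>a\<close> would not have to be a root.\<close>
  have "p \<noteq> 0" using jnf mem by (force simp: jordan_nf_def)
  hence "poly (char_poly A) a = 0"
    unfolding jordan_nf_char_poly[OF jnf] poly_prod_list prod_list_zero_iff
    using mem by (force simp: image_iff)
  hence "eigenvalue A a" using eigenvalue_root_char_poly[OF A] by simp
  then obtain v where v: "eigenvector A v a" unfolding eigenvalue_def by blast
  hence vn: "v \<in> carrier_vec n" "v \<noteq> 0\<^sub>v n" using A by (auto simp: eigenvector_def)
  then obtain i where i: "i < n" "v $ i \<noteq> 0" by (metis eq_vecI carrier_vecD index_zero_vec)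
  have "0\<^sub>m n n *\<^sub>v v = a ^ k \<cdot>\<^sub>v v" using eigenvector_pow[OF A v, of k] k by simp
  from arg_cong[OF this, of "\<lambda>w. w $ i"] i vn have "a ^ k = 0" by simp
  thus ?thesis by simp
qed

section \<open>Monomial labels for a Jordan basis\<close>

text \<open>The basis vector with label \<open>(p, e)\<close> stands for \<open>t ^ e\<close> in the block of size \<open>p\<close>. Since a Jordan block
  maps each basis vector to its predecessor, exponents decrease along a block. A label determines
  its position only if the sizes are distinct.\<close>

definition jordan_labels :: "nat list \<Rightarrow> (nat \<times> nat) list" where
  "jordan_labels ps = concat (map (\<lambda>p. map (Pair p) (rev [0..<p])) ps)"

lemma jordan_labels_simps [simp]:
  "jordan_labels [] = []"
  "jordan_labels (p # ps) = map (Pair p) (rev [0..<p]) @ jordan_labels ps"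
  by (simp_all add: jordan_labels_def)

lemma set_jordan_labels: "set (jordan_labels ps) = Sigma (set ps) (\<lambda>p. {..<p})"
  unfolding jordan_labels_def Sigma_def by (fastforce simp: image_iff)

lemma length_jordan_labels [simp]: "length (jordan_labels ps) = sum_list ps"
  by (induction ps) auto

lemma distinct_jordan_labels: "distinct ps \<Longrightarrow> distinct (jordan_labels ps)"
  by (induction ps) (auto simp: distinct_map set_jordan_labels inj_on_def)

lemma nth_jordan_labels_Cons:
  "jordan_labels (p # ps) ! i = (if i < p then (p, p - Suc i) else jordan_labels ps ! (i - p))"
  by (auto simp: nth_append rev_nth)

text \<open>In terms of labels the matrix is multiplication by t: the ones of a block lie on its
  superdiagonal and exponents decrease along the block, so the column of t^e has its one in the row
  of t^(e+1).\<close>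

lemma jordan_matrix_index:
  assumes "distinct ps" "i < sum_list ps" "j < sum_list ps"
  shows "jordan_matrix (map (\<lambda>p. (p, 0)) ps) $$ (i, j) =
    (if fst (jordan_labels ps ! i) = fst (jordan_labels ps ! j) \<and>
        snd (jordan_labels ps ! i) = Suc (snd (jordan_labels ps ! j)) then 1 else 0)"
  using assms
proof (induction ps arbitrary: i j)
  case (Cons p ps)
  \<comment> \<open>By distinctness no later label carries the size \<open>p\<close>, which gives
    the zeros outside the diagonal blocks.\<close>
  have lab: "fst (jordan_labels ps ! k) \<noteq> p" if "k < sum_list ps" for k
  proof -
    have "jordan_labels ps ! k \<in> set (jordan_labels ps)" using that by (intro nth_mem) simp
    thus ?thesis using Cons.prems(1) by (auto simp: set_jordan_labels)
  qed
  have dim: "sum_list (map fst (map (\<lambda>p. (p, 0::'a)) ps)) = sum_list ps"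
    by (simp add: o_def)
  have ij: "i < p + sum_list ps" "j < p + sum_list ps" using Cons.prems by auto
  note simps = list.map jordan_matrix_Cons dim nth_jordan_labels_Cons
  consider "i < p" "j < p" | "i < p" "\<not> j < p" | "\<not> i < p" "j < p" | "\<not> i < p" "\<not> j < p"
    by blast
  thus ?case
  proof cases
    case 1
    thus ?thesis unfolding simps using ij by auto
  next
    case 2
    hence "j - p < sum_list ps" using ij by linarith
    with 2 show ?thesis unfolding simps using ij lab[of "j - p"] by (auto simp: o_def)
  next
    case 3
    hence "i - p < sum_list ps" using ij by linarith
    with 3 show ?thesis unfolding simps using ij lab[of "i - p"] by (auto simp: o_def)
  next
    case 4
    hence lt: "i - p < sum_list ps" "j - p < sum_list ps" using ij by linarith+
    from Cons.IH[OF _ this] Cons.prems(1)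
    show ?thesis unfolding simps using ij 4 lt by (simp add: o_def)
  qed
qed simp

section \<open>Entries of a matrix commuting with a Jordan matrix\<close>

text \<open>\<open>N\<close> is multiplication by t on the direct sum of the F[t]/(t^p) with p in
  \<open>S\<close>, and \<open>M\<close> is an F[t]-linear endomorphism of it. The order of the
  labels in \<open>L\<close> is left open.\<close>

locale jordan_commutant =
  fixes n :: nat and S :: "nat set" and L :: "(nat \<times> nat) list" and N M :: "'a :: field mat"
  assumes len: "length L = n" and dist: "distinct L"
    and setL: "set L = Sigma S (\<lambda>p. {..<p})"
    and N: "N \<in> carrier_mat n n" and M: "M \<in> carrier_mat n n" and comm: "M * N = N * M"
    and N_index: "\<And>i j. i < n \<Longrightarrow> j < n \<Longrightarrow> N $$ (i, j) =
      (if fst (L ! i) = fst (L ! j) \<and> snd (L ! i) = Suc (snd (L ! j)) then 1 else 0)"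
begin

lemma label_mem: "i < n \<Longrightarrow> L ! i = (p, e) \<Longrightarrow> p \<in> S \<and> e < p"
  using nth_mem[of i L] len setL by auto

lemma label_ex: "p \<in> S \<Longrightarrow> e < p \<Longrightarrow> \<exists>i < n. L ! i = (p, e)"
  using setL len in_set_conv_nth[of "(p, e)" L] by auto

lemma label_inj: "i < n \<Longrightarrow> j < n \<Longrightarrow> L ! i = L ! j \<Longrightarrow> i = j"
  using dist len nth_eq_iff_index_eq by blast

lemma sum_delta:
  assumes "k < n" "\<And>j. j < n \<Longrightarrow> j \<noteq> k \<Longrightarrow> f j = 0"
  shows "(\<Sum>j = 0..<n. f j :: 'a) = f k"
  using assms by (subst sum.remove[of _ k]) (auto intro!: sum.neutral)

lemma index_mult: "A \<in> carrier_mat n n \<Longrightarrow> B \<in> carrier_mat n n \<Longrightarrow> i < n \<Longrightarrow> j < n \<Longrightarrow>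
   (A * B) $$ (i, j) = (\<Sum>k = 0..<n. A $$ (i, k) * B $$ (k, j) :: 'a)"
  by (auto simp: scalar_prod_def)

text \<open>Here and in the next three lemmas the products are read off from multiplication by t. On
  columns, \<open>N\<close> sends t^e to t^(e+1) and kills the top power of a block. On rows, the
  coefficient of t^(f+1) in t x is that of t^f in x, and the coefficient of t^0 in t x is 0.\<close>

lemma MN_Suc:
  assumes "r < n" "c < n" "c' < n" "L ! c = (p, e)" "L ! c' = (p, Suc e)"
  shows "(M * N) $$ (r, c) = M $$ (r, c')"
proof -
  have "N $$ (k, c) = 0" if "k < n" "k \<noteq> c'" for k
    using that assms label_inj[of k c'] by (auto simp: N_index prod_eq_iff)
  hence "(M * N) $$ (r, c) = M $$ (r, c') * N $$ (c', c)"
    unfolding index_mult[OF M N assms(1,2)] by (intro sum_delta[OF assms(3)]) simp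
  thus ?thesis using assms by (simp add: N_index)
qed

lemma MN_top:
  assumes "r < n" "c < n" "L ! c = (p, e)" "Suc e = p"
  shows "(M * N) $$ (r, c) = 0"
proof -
  have "M $$ (r, k) * N $$ (k, c) = 0" if "k < n" for k
    using assms that label_mem[of k "fst (L ! k)" "snd (L ! k)"] by (auto simp: N_index)
  thus ?thesis unfolding index_mult[OF M N assms(1,2)] by (intro sum.neutral) auto
qed

lemma NM_Suc:
  assumes "r < n" "c < n" "r' < n" "L ! r = (q, f)" "L ! r' = (q, Suc f)"
  shows "(N * M) $$ (r', c) = M $$ (r, c)"
proof -
  have "N $$ (r', k) = 0" if "k < n" "k \<noteq> r" for k
    using that assms label_inj[of k r] by (auto simp: N_index prod_eq_iff)
  hence "(N * M) $$ (r', c) = N $$ (r', r) * M $$ (r, c)"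
    unfolding index_mult[OF N M assms(3,2)] by (intro sum_delta[OF assms(1)]) simp
  thus ?thesis using assms by (simp add: N_index)
qed

lemma NM_bot:
  assumes "r < n" "c < n" "L ! r = (q, 0)"
  shows "(N * M) $$ (r, c) = 0"
  unfolding index_mult[OF N M assms(1,2)] using assms by (intro sum.neutral) (auto simp: N_index)

lemma shift_entry:
  assumes "r < n" "c < n" "r' < n" "c' < n" "L ! r = (q, f)" "L ! c = (p, e)"
    "L ! r' = (q, Suc f)" "L ! c' = (p, Suc e)"
  shows "M $$ (r', c') = M $$ (r, c)"
  using MN_Suc[of r' c c' p e] NM_Suc[of r c r' q f] assms comm by simp

lemma entry_nonzero_ge:
  assumes "r < n" "c < n" "L ! r = (q, f)" "L ! c = (p, e)" "M $$ (r, c) \<noteq> 0"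
  shows "e \<le> f"
  using assms
proof (induction e arbitrary: f r c)
  case (Suc e)
  from label_mem[OF Suc.prems(2,4)] label_ex[of p e]
  obtain c' where c': "c' < n" "L ! c' = (p, e)" by auto
  show ?case
  proof (cases f)
    case 0
    thus ?thesis using MN_Suc[of r c' c p e] NM_bot[of r c' q] Suc.prems c' comm by simp
  next
    case (Suc g)
    from label_mem[OF Suc.prems(1,3)] label_ex[of q g] Suc
    obtain r' where r': "r' < n" "L ! r' = (q, g)" by auto
    from shift_entry[of r' c' r c q g p e] Suc Suc.prems r' c'
    have "M $$ (r', c') \<noteq> 0" by simp
    from Suc.IH[OF r'(1) c'(1) r'(2) c'(2) this] Suc show ?thesis by simp
  qed
qed simp

text \<open>The monomial t^e of the block \<open>p\<close> is killed by t^(p-e), hence so is its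
  image. A term t^f of the image in the block \<open>q\<close> must then satisfy f + (p - e) \<ge>
  q. The induction runs over the distance from \<open>e\<close> to the top exponent p - 1.\<close>

lemma entry_nonzero_ge':
  assumes "r < n" "c < n" "L ! r = (q, f)" "L ! c = (p, e)" "M $$ (r, c) \<noteq> 0"
  shows "e + q \<le> f + p"
  using assms
proof (induction "p - Suc e" arbitrary: e f r c)
  case 0
  hence e: "Suc e = p" using label_mem[of c p e] by simp
  have "Suc f = q"
  proof (rule ccontr)
    assume "Suc f \<noteq> q"
    with label_mem[OF 0(2,4)] label_ex[of q "Suc f"]
    obtain r' where "r' < n" "L ! r' = (q, Suc f)" by auto
    with MN_top[of r' c p e] NM_Suc[of r c r' q f] 0 e comm show False by simp
  qed
  with e show ?case by simp
next
  case (Suc d)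
  have "Suc e < p" using Suc(2) by linarith
  with label_mem[OF Suc.prems(2,4)] label_ex[of p "Suc e"]
  obtain c' where c': "c' < n" "L ! c' = (p, Suc e)" by auto
  show ?case
  proof (cases "Suc f = q")
    case True
    thus ?thesis using Suc(2) by simp
  next
    case False
    with label_mem[OF Suc.prems(1,3)] label_ex[of q "Suc f"]
    obtain r' where r': "r' < n" "L ! r' = (q, Suc f)" by auto
    have "M $$ (r', c') \<noteq> 0" using shift_entry[of r c r' c' q f p e] Suc.prems r' c' by simp
    from Suc.hyps(1)[OF _ r'(1) c'(1) r'(2) c'(2) this] Suc(2) show ?thesis by simp
  qed
qed

end

section \<open>Vanishing diagonal of a nilpotent commuting matrix\<close>

lemma (in jordan_commutant) pow_commutant: "jordan_commutant n S L N (M ^\<^sub>m k)"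
  by unfold_locales
    (use len dist setL N M N_index pow_mat_mult_commute[OF M N comm] in auto)

text \<open>In the product \<open>M ^\<^sub>m k * M\<close> only the path through \<open>d\<close>
  itself contributes. For a path through a label (q, f), the entry bounds on the power give f = 0
  and p \<le> q, and the bound on \<open>M\<close> then gives q \<le> p; as labels are distinct,
  this is \<open>d\<close>.\<close>

lemma (in jordan_commutant) pow_diag:
  assumes d: "d < n" "L ! d = (p, 0)"
  shows "(M ^\<^sub>m k) $$ (d, d) = (M $$ (d, d)) ^ k"
proof (induction k)
  case 0
  show ?case using d M by simp
next
  case (Suc k)
  interpret P: jordan_commutant n S L N "M ^\<^sub>m k" by (rule pow_commutant)
  have "(M ^\<^sub>m Suc k) $$ (d, d) = (M ^\<^sub>m k) $$ (d, d) * M $$ (d, d)"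
    unfolding pow_mat.simps index_mult[OF P.M M d(1,1)]
  proof (rule sum_delta[OF d(1)])
    fix j assume j: "j < n" "j \<noteq> d"
    obtain q f where qf: "L ! j = (q, f)" by force
    show "(M ^\<^sub>m k) $$ (d, j) * M $$ (j, d) = 0"
    proof (rule ccontr)
      assume "\<not> ?thesis"
      hence nz: "(M ^\<^sub>m k) $$ (d, j) \<noteq> 0" "M $$ (j, d) \<noteq> 0" by auto
      from P.entry_nonzero_ge[OF d(1) j(1) d(2) qf nz(1)] P.entry_nonzero_ge'[OF d(1) j(1) d(2) qf nz(1)]
        entry_nonzero_ge'[OF j(1) d(1) qf d(2) nz(2)]
      have "L ! j = L ! d" using qf d by simp
      with label_inj j d show False by blast
    qed
  qed
  thus ?case using Suc by simp
qed

text \<open>At exponent 0 the entry has a vanishing power. All other diagonal entries of the same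
  block equal this one by linearity over F[t].\<close>

lemma (in jordan_commutant) nilpotent_diag:
  assumes nil: "nilpotent_mat M" and c: "c < n" "L ! c = (p, e)"
  shows "M $$ (c, c) = 0"
  using c
proof (induction e arbitrary: c)
  case 0
  from nil M obtain k where "M ^\<^sub>m k = 0\<^sub>m n n" by (auto simp: nilpotent_mat_def)
  with pow_diag[OF 0, of k] 0 show ?case by simp
next
  case (Suc e)
  from label_mem[OF Suc.prems] label_ex[of p e]
  obtain c' where c': "c' < n" "L ! c' = (p, e)" by auto
  from shift_entry[OF c'(1,1) Suc.prems(1,1) c'(2,2) Suc.prems(2,2)] Suc.IH[OF c']
  show ?case by simp
qed

section \<open>Counting the parts below a bound\<close>

text \<open>This is the function h of the filtration. Its second argument is any natural number,
  since the shift a is its value at the exponent m of the power.\<close>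

definition num_below :: "nat set \<Rightarrow> nat \<Rightarrow> nat" where
  "num_below S x = card {q \<in> S. q < x}"

lemma num_below_mono:
  assumes "x \<le> y" shows "num_below S x \<le> num_below S y"
  unfolding num_below_def
  by (rule card_mono) (use assms in auto)

lemma num_below_le:
  assumes "x \<le> y" shows "num_below S y \<le> num_below S x + (y - x)"
proof -
  have "num_below S y \<le> card ({q \<in> S. q < x} \<union> {x..<y})"
    unfolding num_below_def by (rule card_mono) auto
  also have "\<dots> \<le> num_below S x + (y - x)"
    unfolding num_below_def using card_Un_le[of "{q \<in> S. q < x}" "{x..<y}"] by simp
  finally show ?thesis .
qed

lemma num_below_less:
  assumes "q \<in> S" "q < p" shows "num_below S q < num_below S p"
  unfolding num_below_def
  by (rule psubset_card_mono) (use assms in auto)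

text \<open>This is where the difference of at least 2 enters: p - 1 is not in \<open>S\<close>, so
  the count does not grow in the last unit step from \<open>q\<close> to \<open>p\<close> and grows
  by at most 1 in each of the others.\<close>

lemma num_below_gap:
  assumes gap: "\<And>p q. p \<in> S \<Longrightarrow> q \<in> S \<Longrightarrow> q < p \<Longrightarrow> q + 2 \<le> p"
    and "p \<in> S" "q \<in> S" "q < p"
  shows "num_below S p + q < num_below S q + p"
proof -
  have "num_below S p = num_below S (p - 1)"
    unfolding num_below_def by (rule arg_cong[of _ _ card]) (use gap assms(2) in fastforce)
  moreover have "q + 2 \<le> p" using assms by blast
  moreover from this have "q \<le> p - 1" by linarith
  from num_below_le[OF this, of S] have "num_below S (p - 1) \<le> num_below S q + (p - 1 - q)" .
  ultimately show ?thesis by linarith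
qed

section \<open>The filtration raised by a nilpotent commuting matrix\<close>

text \<open>The filtration exponents \<open>s + num_below S p - a\<close> below use truncated subtraction, which supplies
  the maximum with \<open>0\<close>.\<close>

locale gapped_nilpotent_commutant = jordan_commutant +
  assumes gap: "\<And>p q. p \<in> S \<Longrightarrow> q \<in> S \<Longrightarrow> q < p \<Longrightarrow> q + 2 \<le> p"
    and nil: "nilpotent_mat M" and fin: "finite S"
begin

text \<open>Within one block the vanishing diagonal raises the exponent. Into a smaller block the
  exponent does not drop, while the count drops by at least 1. Into a larger block the exponent
  rises by at least q - p, which exceeds the growth of the count.\<close>

lemma shift_filtration:
  assumes rc: "r < n" "c < n" "L ! r = (q, f)" "L ! c = (p, e)" and nz: "M $$ (r, c) \<noteq> 0"
    and e: "s + num_below S p - a \<le> e"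
  shows "Suc s + num_below S q - a \<le> f"
proof -
  note S = label_mem[OF rc(1,3)] label_mem[OF rc(2,4)]
  note ge = entry_nonzero_ge[OF rc nz] entry_nonzero_ge'[OF rc nz]
  consider "p = q" | "q < p" | "p < q" by linarith
  thus ?thesis
  proof cases
    case 1
    have "e \<noteq> f"
    proof
      assume "e = f"
      hence "r = c" using label_inj[OF rc(1,2)] rc 1 by simp
      thus False using nilpotent_diag[OF nil rc(2,4)] nz by simp
    qed
    thus ?thesis using ge e 1 by simp
  next
    case 2
    thus ?thesis using num_below_less[where S = S and p = p and q = q] S ge e by simp
  next
    case 3
    thus ?thesis using num_below_gap[where S = S and p = q and q = p, OF gap] S ge e by simp
  qed
qed

lemma pow_shift_filtration:
  assumes "r < n" "c < n" "L ! r = (q, f)" "L ! c = (p, e)" "(M ^\<^sub>m s) $$ (r, c) \<noteq> 0"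
    and "num_below S p - a \<le> e"
  shows "s + num_below S q - a \<le> f"
  using assms
proof (induction s arbitrary: r q f)
  case 0
  hence "r = c" using M by (auto split: if_splits)
  thus ?case using 0 by simp
next
  case (Suc s)
  have Ms: "M ^\<^sub>m s \<in> carrier_mat n n" using M by simp
  \<comment> \<open>The power is defined with the new factor on the right, but the induction fixes
    the column and varies the row, so the factor is moved to the left.\<close>
  have "M ^\<^sub>m Suc s = M * M ^\<^sub>m s" using pow_mat_mult_commute[OF M M refl] by simp
  with Suc.prems(5) index_mult[OF M Ms Suc.prems(1,2)]
  have "(\<Sum>k = 0..<n. M $$ (r, k) * (M ^\<^sub>m s) $$ (k, c)) \<noteq> 0" by simp
  then obtain k where k: "k < n" "M $$ (r, k) \<noteq> 0" "(M ^\<^sub>m s) $$ (k, c) \<noteq> 0"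
    by (metis (no_types, lifting) atLeastLessThan_iff mult_zero_left mult_zero_right sum.neutral)
  obtain q' f' where l: "L ! k = (q', f')" by force
  from Suc.IH[OF k(1) Suc.prems(2) l Suc.prems(4) k(3) Suc.prems(6)]
  show ?case by (rule shift_filtration[OF Suc.prems(1) k(1) Suc.prems(3) l k(2)])
qed

text \<open>This is the dimension of the sum of the t^(c p) F[t]/(t^p). A block with c p \<ge> p
  contributes 0, in agreement with truncated subtraction.\<close>

lemma card_labels:
  "card {i. i < n \<and> c (fst (L ! i)) \<le> snd (L ! i)} = (\<Sum>p\<in>S. p - c p)"
proof -
  have "bij_betw ((!) L) {i. i < n \<and> c (fst (L ! i)) \<le> snd (L ! i)} (Sigma S (\<lambda>p. {c p..<p}))"
  proof (rule bij_betw_imageI)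
    show "inj_on ((!) L) {i. i < n \<and> c (fst (L ! i)) \<le> snd (L ! i)}"
      using label_inj by (auto intro: inj_onI)
    show "(!) L ` {i. i < n \<and> c (fst (L ! i)) \<le> snd (L ! i)} = Sigma S (\<lambda>p. {c p..<p})"
    proof (intro equalityI subsetI)
      fix x assume "x \<in> (!) L ` {i. i < n \<and> c (fst (L ! i)) \<le> snd (L ! i)}"
      then obtain i where i: "i < n" "c (fst x) \<le> snd x" "L ! i = x" by blast
      from label_mem[of i "fst x" "snd x"] i have "fst x \<in> S \<and> snd x < fst x" by simp
      with i(2) show "x \<in> Sigma S (\<lambda>p. {c p..<p})" by (cases x) simp
    next
      fix x assume "x \<in> Sigma S (\<lambda>p. {c p..<p})"
      then obtain p e where x: "x = (p, e)" "p \<in> S" "c p \<le> e" "e < p" by (elim SigmaE) simp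
      from label_ex[OF x(2,4)] obtain i where "i < n" "L ! i = (p, e)" by blast
      with x show "x \<in> (!) L ` {i. i < n \<and> c (fst (L ! i)) \<le> snd (L ! i)}"
        by (intro image_eqI[of _ _ i]) simp_all
    qed
  qed
  from bij_betw_same_card[OF this] show ?thesis using fin by simp
qed

lemma kernel_dim_pow_ge: "(\<Sum>p\<in>S. min m p) \<le> kernel_dim (M ^\<^sub>m m)"
proof -
  define X where "X s = {i. i < n \<and> s + num_below S (fst (L ! i)) - num_below S m \<le> snd (L ! i)}" for s
  have card_X: "card (X s) = (\<Sum>p\<in>S. p - (s + num_below S p - num_below S m))" for s
    unfolding X_def by (rule card_labels)
  \<comment> \<open>This is why the shift is \<open>num_below S m\<close>. For m \<le> p the count
    grows from m to p by at least 0 and at most p - m, so no subtraction truncates. For p < m the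
    subtracted amount on the left is at least p and the one on the right is 0, so both sides are
    p.\<close>
  have "min m p + (p - (m + num_below S p - num_below S m))
      = p - (0 + num_below S p - num_below S m)" for p
    using num_below_mono[of m p S] num_below_le[of m p S]
      num_below_mono[of p m S] num_below_le[of p m S]
    by (cases "m \<le> p") simp_all
  hence "(\<Sum>p\<in>S. min m p) + card (X m) = card (X 0)"
    unfolding card_X sum.distrib[symmetric] by simp
  moreover have "card (X 0) \<le> kernel_dim (M ^\<^sub>m m) + card (X m)"
  proof (rule kernel_dim_zero_block)
    fix i j assume ij: "i < n" "j \<in> X 0" "i \<notin> X m"
    obtain p e q f where l: "L ! i = (q, f)" "L ! j = (p, e)" by (metis surj_pair)
    show "(M ^\<^sub>m m) $$ (i, j) = 0"
      using pow_shift_filtration[of i j q f p e m "num_below S m"] ij l by (auto simp: X_def)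
  qed (use M in \<open>auto simp: X_def\<close>)
  ultimately show ?thesis by simp
qed

end

section \<open>Super-distinct partitions as sets of parts\<close>

lemma super_distinct_sorted_wrt:
  assumes "super_distinct Q"
  shows "sorted_wrt (\<lambda>x y. y + 2 \<le> x) Q"
proof -
  have "transp (\<lambda>x y :: nat. y + 2 \<le> x)" by (rule transpI) simp
  thus ?thesis using assms by (simp add: sorted_wrt_iff_nth_Suc_transp super_distinct_def)
qed

lemma super_distinct_strict:
  assumes "super_distinct Q"
  shows "sorted_wrt (>) Q"
  using super_distinct_sorted_wrt[OF assms] by (rule sorted_wrt_mono_rel[rotated]) simp

lemma super_distinct_gap:
  assumes "super_distinct Q" "p \<in> set Q" "q \<in> set Q" "q < p"
  shows "q + 2 \<le> p"
proof -
  obtain i j where ij: "i < length Q" "j < length Q" "p = Q ! i" "q = Q ! j"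
    using assms(2,3) by (metis in_set_conv_nth)
  have "i \<noteq> j" using ij assms(4) by auto
  thus ?thesis
    using sorted_wrt_nth_less[OF super_distinct_sorted_wrt[OF assms(1)], of i j]
      sorted_wrt_nth_less[OF super_distinct_sorted_wrt[OF assms(1)], of j i] ij assms(4)
    by (cases "i < j") auto
qed

lemma super_distinct_imp_distinct: "super_distinct Q \<Longrightarrow> distinct Q"
  using super_distinct_strict strict_sorted_iff[of "rev Q"] by (simp add: sorted_wrt_rev)

lemma super_distinct_eqI:
  assumes "super_distinct Q" "super_distinct R" "set Q = set R"
  shows "Q = R"
proof -
  have "rev Q = rev R"
    using super_distinct_strict[OF assms(1)] super_distinct_strict[OF assms(2)] assms(3)
    by (intro strict_sorted_equal) (auto simp: sorted_wrt_rev)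
  thus ?thesis by simp
qed

section \<open>Comparison of Jordan types\<close>

text \<open>Conjugation that brings \<open>B\<close> into Jordan form \<open>J\<close> turns
  \<open>A\<close> into a matrix \<open>A'\<close> commuting with \<open>J\<close>, to which the
  filtration bound applies. At eigenvalue 0 the generalized eigenspace dimensions are the kernel
  dimensions of the powers.\<close>

lemma dim_gen_eigenspace_commuting_le:
  fixes A B :: "'a :: field mat"
  assumes A: "A \<in> carrier_mat n n" and B: "B \<in> carrier_mat n n"
    and nil: "nilpotent_mat A" "nilpotent_mat B" and comm: "A * B = B * A"
    and type: "has_jordan_type B R" and R: "super_distinct R"
  shows "dim_gen_eigenspace B 0 m \<le> dim_gen_eigenspace A 0 m"
proof -
  from type obtain n_as where jnf: "jordan_nf B n_as" and mset: "mset (map fst n_as) = mset R"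
    by (auto simp: has_jordan_type_def)
  define ps where "ps = map fst n_as"
  have n_as: "n_as = map (\<lambda>p. (p, 0)) ps"
    unfolding ps_def map_map o_def
    by (rule map_idI[symmetric]) (use jordan_nf_nilpotent_eigenvalue[OF nil(2) jnf] in auto)
  have set_ps: "set ps = set R" using mset ps_def mset_eq_setD by blast
  have dist: "distinct ps"
    using mset super_distinct_imp_distinct[OF R] ps_def mset_eq_imp_distinct_iff by blast
  from jnf obtain P P' where wit: "similar_mat_wit B (jordan_matrix n_as) P P'"
    by (auto simp: jordan_nf_def similar_mat_def)
  note w = similar_mat_witD2[OF B wit]
  define J where "J = jordan_matrix n_as"
  define A' where "A' = P' * A * P"
  have J: "J \<in> carrier_mat n n" using w(5) by (simp add: J_def)
  have n: "n = sum_list ps" using J by (auto simp: J_def ps_def)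
  have A': "A' \<in> carrier_mat n n" using w(6,7) A by (simp add: A'_def)
  have witA: "similar_mat_wit A' A P' P"
    by (rule similar_mat_witI[OF w(2,1) A'_def A' A w(7,6)])
  have "J = P' * B * P"
    unfolding J_def by (rule similar_mat_witD(3)[OF refl similar_mat_wit_sym[OF wit]])
  have cancel: "P * (P' * X) = X" if "X \<in> carrier_mat n n" for X
    using assoc_mult_mat[OF w(6,7) that] w(1) that by simp
  note assoc = assoc_mult_mat[of _ n n _ n _ n]
  have "A' * J = P' * (A * B) * P"
    unfolding A'_def \<open>J = P' * B * P\<close> using w(6,7) A B by (simp add: assoc cancel)
  also have "\<dots> = J * A'"
    unfolding comm A'_def \<open>J = P' * B * P\<close> using w(6,7) A B by (simp add: assoc cancel)
  finally have comm': "A' * J = J * A'" .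
  interpret gapped_nilpotent_commutant n "set ps" "jordan_labels ps" J A'
  proof unfold_locales
    show "J $$ (i, j) = (if fst (jordan_labels ps ! i) = fst (jordan_labels ps ! j) \<and>
        snd (jordan_labels ps ! i) = Suc (snd (jordan_labels ps ! j)) then 1 else 0)"
      if "i < n" "j < n" for i j
      using that unfolding J_def n_as n by (rule jordan_matrix_index[OF dist])
    show "nilpotent_mat A'" by (rule nilpotent_mat_similar[OF nil(1) similar_mat_wit_sym[OF witA]])
  qed (use n J A' comm' super_distinct_gap[OF R] in
      \<open>simp_all add: distinct_jordan_labels[OF dist] set_jordan_labels set_ps\<close>)
  \<comment> \<open>Each block of size p contributes \<open>min m p\<close> to the kernel of the
    m-th power.\<close>
  have "dim_gen_eigenspace B 0 m = sum_list (map (min m) ps)"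
    unfolding dim_gen_eigenspace[OF jnf] n_as by (simp add: filter_map o_def)
  also have "\<dots> = (\<Sum>p\<in>set ps. min m p)" using \<open>distinct ps\<close>
    by (simp add: sum_list_distinct_conv_sum_set)
  also have "\<dots> \<le> kernel_dim (A' ^\<^sub>m m)" by (rule kernel_dim_pow_ge)
  also have "char_matrix A' 0 = A'" using A' by (auto simp: char_matrix_def)
  hence "kernel_dim (A' ^\<^sub>m m) = dim_gen_eigenspace A' 0 m" by (simp add: dim_gen_eigenspace_def)
  also have "\<dots> = dim_gen_eigenspace A 0 m"
    using witA dim_gen_eigenspace_similar by (metis similar_mat_def)
  finally show ?thesis .
qed

text \<open>The number of blocks of a given positive size is computed from the kernel dimensions of
  powers, so equal dimensions give equal numbers of blocks for the eigenvalue 0.\<close>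

lemma jordan_type_subset:
  fixes A B :: "'a :: field mat"
  assumes dim: "\<And>k. dim_gen_eigenspace A 0 k = dim_gen_eigenspace B 0 k"
    and nil: "nilpotent_mat A" and A: "has_jordan_type A Q" and B: "has_jordan_type B R"
  shows "set Q \<subseteq> set R"
proof
  from A obtain n_as where nA: "jordan_nf A n_as" "mset (map fst n_as) = mset Q"
    by (auto simp: has_jordan_type_def)
  from B obtain n_bs where nB: "jordan_nf B n_bs" "mset (map fst n_bs) = mset R"
    by (auto simp: has_jordan_type_def)
  fix p assume "p \<in> set Q"
  hence "p \<in> fst ` set n_as" using mset_eq_setD[OF nA(2)] by simp
  then obtain a where a: "(p, a) \<in> set n_as" by auto
  with jordan_nf_nilpotent_eigenvalue[OF nil nA(1)] have mem: "(p, 0) \<in> set n_as" by blast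
  with nA(1) have p: "p \<noteq> 0" by (force simp: jordan_nf_def)
  have "length (filter ((=) (p, 0)) n_as) = length (filter ((=) (p, 0)) n_bs)"
    unfolding compute_nr_of_jordan_blocks[OF nA(1) p, symmetric]
      compute_nr_of_jordan_blocks[OF nB(1) p, symmetric] compute_nr_of_jordan_blocks_def dim ..
  moreover have "filter ((=) (p, 0)) n_as \<noteq> []" using mem by (auto simp: filter_empty_conv)
  ultimately have "filter ((=) (p, 0)) n_bs \<noteq> []" by auto
  hence "(p, 0) \<in> set n_bs" by (auto simp: filter_empty_conv)
  hence "p \<in> set (map fst n_bs)" by force
  thus "p \<in> set R" using mset_eq_setD[OF nB(2)] by simp
qed

theorem theorem4p3:
  fixes Q R :: "nat list" and m n :: nat
  assumes "infinite (UNIV :: 'a :: field set)"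
    and "partition_of m Q" and "super_distinct Q"
    and "partition_of n R" and "super_distinct R"
    and "Q \<noteq> R"
  shows "\<not> commuting_partitions TYPE('a) Q R"
proof
  assume "commuting_partitions TYPE('a) Q R"
  then obtain d and A B :: "'a mat" where AB: "A \<in> carrier_mat d d" "B \<in> carrier_mat d d"
    and nil: "nilpotent_mat A" "nilpotent_mat B" and comm: "A * B = B * A"
    and type: "has_jordan_type A Q" "has_jordan_type B R"
    unfolding commuting_partitions_def by blast
  have dim: "dim_gen_eigenspace A 0 k = dim_gen_eigenspace B 0 k" for k
    using dim_gen_eigenspace_commuting_le[OF AB nil comm type(2) assms(5)]
      dim_gen_eigenspace_commuting_le[OF AB(2,1) nil(2,1) comm[symmetric] type(1) assms(3)]
    by (rule order_antisym[rotated])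
  have "set Q = set R"
    using jordan_type_subset[OF dim nil(1) type] jordan_type_subset[OF dim[symmetric] nil(2) type(2,1)]
    by blast
  with super_distinct_eqI assms show False by blast
qed

end
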